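(* Let $G$ be a graph with $n$ vertices and $m$ edges, with maximum degree $\triangle$ and minimum degree $\delta$. Then $$\delta^2\le \frac{HM_2(G)}{2(M_1(G)-2m)}\le \triangle^2,$$ and the equality holds if and only if $G$ is a regular graph.
   Context: Graphs are finite, without loops or multiple edges. For a vertex $u$, $d(u)$ is its degree; $\triangle$ and $\delta$ are the maximum and minimum vertex degree of $G$. For an edge $e=uv$ the edge degree is $d(e)=d(u)+d(v)$. The first Zagreb index is $M_1(G)=\sum_{v\in V(G)}d(v)^2$. The second hyper-Zagreb index is $HM_2(G)=\sum_{e\sim f}d(e)d(f)$, where the sum is over the pairs $\{e,f\}$ of adjacent edges of $G$ (edges having a common endpoint), each pair counted once. A graph is regular if every vertex has the same degree.
   Formalization: The quotient is assumed to have M_1(G) ≠ 2m; the upper equality alone is characterized by regularity only for connected G (it fails for a triangle plus a disjoint edge), while the bounds, the lower equality and both equalities together are treated for all graphs. *)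

theory Defs
  imports Complex_Main
begin

text \<open>A graph is a vertex set \<open>V\<close> with a set \<open>E\<close> of two-element subsets of \<open>V\<close>, which excludes
  loops and multiple edges.\<close>

definition simple_graph :: "'a set \<Rightarrow> 'a set set \<Rightarrow> bool" where
  "simple_graph V E \<longleftrightarrow> finite V \<and> (\<forall>e\<in>E. e \<subseteq> V \<and> card e = 2)"

definition degree :: "'a set set \<Rightarrow> 'a \<Rightarrow> nat" where
  "degree E v = card {e \<in> E. v \<in> e}"

text \<open>The next two are meaningful only for finite nonempty \<open>V\<close>.\<close>

definition max_degree :: "'a set \<Rightarrow> 'a set set \<Rightarrow> nat" where
  "max_degree V E = Max (degree E ` V)"

definition min_degree :: "'a set \<Rightarrow> 'a set set \<Rightarrow> nat" where
  "min_degree V E = Min (degree E ` V)"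

definition regular_graph :: "'a set \<Rightarrow> 'a set set \<Rightarrow> bool" where
  "regular_graph V E \<longleftrightarrow> (\<exists>k. \<forall>v\<in>V. degree E v = k)"

definition connected_graph :: "'a set \<Rightarrow> 'a set set \<Rightarrow> bool" where
  "connected_graph V E \<longleftrightarrow> (\<forall>u\<in>V. \<forall>v\<in>V. (u, v) \<in> {(x, y). {x, y} \<in> E}\<^sup>*)"

text \<open>For \<open>e = {u, v}\<close> this is \<open>d(u) + d(v)\<close>.\<close>

definition edge_degree :: "'a set set \<Rightarrow> 'a set \<Rightarrow> nat" where
  "edge_degree E e = (\<Sum>v\<in>e. degree E v)"

definition first_zagreb :: "'a set \<Rightarrow> 'a set set \<Rightarrow> nat" where
  "first_zagreb V E = (\<Sum>v\<in>V. (degree E v)\<^sup>2)"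

text \<open>Pairs of adjacent edges are unordered, so that each pair is counted once below. As \<open>e \<noteq> f\<close>,
  the product over \<open>{e, f}\<close> is \<open>d(e) d(f)\<close>.\<close>

definition adjacent_edge_pairs :: "'a set set \<Rightarrow> 'a set set set" where
  "adjacent_edge_pairs E = {{e, f} | e f. e \<in> E \<and> f \<in> E \<and> e \<noteq> f \<and> e \<inter> f \<noteq> {}}"

definition second_hyper_zagreb :: "'a set set \<Rightarrow> nat" where
  "second_hyper_zagreb E = (\<Sum>p\<in>adjacent_edge_pairs E. \<Prod>e\<in>p. edge_degree E e)"

end

theory Submission
  imports Defs
begin

text \<open>Two distinct edges share at most one vertex, so the adjacent pairs of edges are partitioned
  by their common vertex and \<open>M\<^sub>1 - 2m = \<Sum> d(v) (d(v) - 1)\<close> is twice their number \<open>N\<close>. Hence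
  \<open>R = HM\<^sub>2 / (4 N)\<close> is a quarter of the average of \<open>d(e) d(f)\<close>, and each such product lies between
  \<open>4\<delta>\<^sup>2\<close> and \<open>4\<Delta>\<^sup>2\<close>. If one of the bounds is attained, then all endpoints of all edges that
  have an adjacent edge have the extremal degree. For the lower bound this gives \<open>\<delta> \<ge> 2\<close>, so every
  vertex is such an endpoint; for the upper bound the degree \<open>\<Delta> \<ge> 2\<close> propagates along paths.\<close>

section \<open>Edges, their endpoints and the handshake identity\<close>

lemma finite_edges:
  assumes "simple_graph V E"
  shows "finite E"
proof -
  have "E \<subseteq> Pow V" "finite V" using assms unfolding simple_graph_def by auto
  then show ?thesis by (meson finite_Pow_iff finite_subset)
qed

lemma edgeE:
  assumes "simple_graph V E" "e \<in> E"
  obtains u v where "e = {u, v}" "u \<noteq> v" "u \<in> V" "v \<in> V"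
  using assms unfolding simple_graph_def by (metis card_2_iff insert_subset)

lemma edge_eq_if_two_common:
  assumes "simple_graph V E" "e \<in> E" "f \<in> E" "u \<in> e" "u \<in> f" "v \<in> e" "v \<in> f" "u \<noteq> v"
  shows "e = f"
  using edgeE[OF assms(1,2)] edgeE[OF assms(1,3)] assms(4-8) by (metis doubleton_eq_iff insertE singletonD)

lemma sum_degree:
  assumes "simple_graph V E"
  shows "(\<Sum>v\<in>V. degree E v) = 2 * card E"
proof -
  have "finite V" using assms unfolding simple_graph_def by simp
  moreover have "card {v \<in> V. v \<in> e} = 2" if "e \<in> E" for e
  proof -
    have "{v \<in> V. v \<in> e} = e" using assms that unfolding simple_graph_def by auto
    then show ?thesis using assms that unfolding simple_graph_def by auto
  qed
  ultimately show ?thesis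
    unfolding degree_def using finite_edges[OF assms]
    by (subst sum_multicount[of V E "\<lambda>v e. v \<in> e" 2]) auto
qed

section \<open>Counting adjacent pairs of edges by their common vertex\<close>

lemma adjacent_edge_pairs_eq_UN:
  assumes "simple_graph V E"
  shows "adjacent_edge_pairs E = (\<Union>v\<in>V. {p. p \<subseteq> {e \<in> E. v \<in> e} \<and> card p = 2})"
proof (intro equalityI subsetI)
  fix p assume "p \<in> adjacent_edge_pairs E"
  then obtain e f v where "p = {e, f}" "e \<in> E" "f \<in> E" "e \<noteq> f" "v \<in> e" "v \<in> f"
    unfolding adjacent_edge_pairs_def by blast
  moreover then have "v \<in> V" using assms unfolding simple_graph_def by auto
  ultimately show "p \<in> (\<Union>v\<in>V. {p. p \<subseteq> {e \<in> E. v \<in> e} \<and> card p = 2})" by auto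
next
  fix p assume "p \<in> (\<Union>v\<in>V. {p. p \<subseteq> {e \<in> E. v \<in> e} \<and> card p = 2})"
  then obtain v where v: "p \<subseteq> {e \<in> E. v \<in> e}" "card p = 2" by blast
  then obtain e f where "p = {e, f}" "e \<noteq> f" by (meson card_2_iff)
  then show "p \<in> adjacent_edge_pairs E" using v unfolding adjacent_edge_pairs_def by blast
qed

lemma finite_adjacent_edge_pairs:
  assumes "simple_graph V E"
  shows "finite (adjacent_edge_pairs E)"
proof (rule finite_subset)
  show "adjacent_edge_pairs E \<subseteq> Pow E" unfolding adjacent_edge_pairs_def by blast
qed (use finite_edges[OF assms] in simp)

lemma card_adjacent_edge_pairs:
  assumes "simple_graph V E"
  shows "card (adjacent_edge_pairs E) = (\<Sum>v\<in>V. degree E v choose 2)"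
proof -
  let ?P = "\<lambda>v. {p. p \<subseteq> {e \<in> E. v \<in> e} \<and> card p = 2}"
  have fin: "finite E" by (rule finite_edges[OF assms])
  \<comment> \<open>A pair counted at both \<open>u\<close> and \<open>v\<close> would consist of
    two distinct edges through both vertices, which a simple graph does not have.\<close>
  have "?P u \<inter> ?P v = {}" if "u \<noteq> v" for u v
  proof (rule ccontr)
    assume "?P u \<inter> ?P v \<noteq> {}"
    then obtain p where p: "p \<subseteq> {e \<in> E. u \<in> e}" "p \<subseteq> {e \<in> E. v \<in> e}" "card p = 2" by blast
    then obtain e f where "p = {e, f}" "e \<noteq> f" by (meson card_2_iff)
    then show False using p that edge_eq_if_two_common[OF assms, of e f u v] by auto
  qed
  moreover have "finite (?P v)" for v
    using fin by (intro finite_subset[of "?P v" "Pow E"]) auto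
  ultimately have "card (\<Union>v\<in>V. ?P v) = (\<Sum>v\<in>V. card (?P v))"
    using assms unfolding simple_graph_def by (intro card_UN_disjoint) auto
  also have "\<dots> = (\<Sum>v\<in>V. degree E v choose 2)"
    unfolding degree_def using fin by (intro sum.cong refl n_subsets) auto
  finally show ?thesis using adjacent_edge_pairs_eq_UN[OF assms] by simp
qed

text \<open>Summing \<open>d\<^sup>2 = d + 2 * (d choose 2)\<close> over the vertices splits into
  the handshake sum and twice the pair count. The additive form avoids truncated subtraction on
  \<open>nat\<close>.\<close>

lemma first_zagreb_eq:
  assumes "simple_graph V E"
  shows "first_zagreb V E = 2 * card E + 2 * card (adjacent_edge_pairs E)"
proof -
  have "d\<^sup>2 = d + 2 * (d choose 2)" for d :: nat
    by (cases d) (auto simp: choose_two power2_eq_square)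
  then have "first_zagreb V E = (\<Sum>v\<in>V. degree E v + 2 * (degree E v choose 2))"
    unfolding first_zagreb_def by simp
  then show ?thesis
    using sum_degree[OF assms] card_adjacent_edge_pairs[OF assms]
    by (simp add: sum.distrib sum_distrib_left)
qed

section \<open>Bounds on degrees, edge degrees and their products\<close>

lemma degree_bounds:
  assumes "simple_graph V E" "v \<in> V"
  shows "min_degree V E \<le> degree E v" "degree E v \<le> max_degree V E"
  using assms unfolding simple_graph_def min_degree_def max_degree_def by auto

lemma edge_degree_bounds:
  assumes "simple_graph V E" "e \<in> E"
  shows "2 * min_degree V E \<le> edge_degree E e" "edge_degree E e \<le> 2 * max_degree V E"
  using assms(2) sum_bounded_below[of e "min_degree V E" "degree E"]
    sum_bounded_above[of e "degree E" "max_degree V E"] degree_bounds[OF assms(1)] assms(1)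
  unfolding edge_degree_def simple_graph_def by (auto simp: subset_iff)

text \<open>An endpoint of \<open>e\<close> is incident with \<open>e\<close> itself. Positivity is
  what keeps a strict inequality between edge degrees strict after multiplication by another edge
  degree.\<close>

lemma edge_degree_pos:
  assumes "simple_graph V E" "e \<in> E"
  shows "0 < edge_degree E e"
proof -
  obtain u v where e: "e = {u, v}" "u \<noteq> v" using edgeE[OF assms] .
  have "0 < degree E u"
    unfolding degree_def using e assms finite_edges[OF assms(1)] by (auto simp: card_gt_0_iff)
  then show ?thesis unfolding edge_degree_def using e by simp
qed

text \<open>Two numbers that are both at least \<delta>, or both at most \<Delta>, can sum to twice
  that bound only if each equals it.\<close>

lemma degree_eq_if_edge_degree_extremal:
  assumes "simple_graph V E" "e \<in> E" "v \<in> e"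
  shows "edge_degree E e = 2 * min_degree V E \<Longrightarrow> degree E v = min_degree V E"
    and "edge_degree E e = 2 * max_degree V E \<Longrightarrow> degree E v = max_degree V E"
proof -
  obtain a b where e: "e = {a, b}" "a \<noteq> b" "a \<in> V" "b \<in> V" using edgeE[OF assms(1,2)] .
  note bounds = degree_bounds[OF assms(1) e(3)] degree_bounds[OF assms(1) e(4)]
  show "edge_degree E e = 2 * min_degree V E \<Longrightarrow> degree E v = min_degree V E"
    and "edge_degree E e = 2 * max_degree V E \<Longrightarrow> degree E v = max_degree V E"
    using bounds e(1,2) assms(3) unfolding edge_degree_def by auto
qed

lemma edge_pair_prod_bounds:
  assumes "simple_graph V E" "p \<in> adjacent_edge_pairs E"
  shows "4 * (min_degree V E)\<^sup>2 \<le> (\<Prod>e\<in>p. edge_degree E e)"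
    and "(\<Prod>e\<in>p. edge_degree E e) \<le> 4 * (max_degree V E)\<^sup>2"
proof -
  obtain e f where p: "p = {e, f}" "e \<in> E" "f \<in> E" "e \<noteq> f"
    using assms(2) unfolding adjacent_edge_pairs_def by blast
  note b = edge_degree_bounds[OF assms(1) p(2)] edge_degree_bounds[OF assms(1) p(3)]
  show "4 * (min_degree V E)\<^sup>2 \<le> (\<Prod>e\<in>p. edge_degree E e)"
    using mult_mono[OF b(1,3)] p by (simp add: power2_eq_square)
  show "(\<Prod>e\<in>p. edge_degree E e) \<le> 4 * (max_degree V E)\<^sup>2"
    using mult_mono[OF b(2,4)] p by (simp add: power2_eq_square)
qed

text \<open>The bounds on the quotient with its denominator cleared, obtained by bounding each of
  the \<open>N\<close> summands; they stay within \<open>nat\<close>.\<close>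

lemma second_hyper_zagreb_bounds:
  assumes "simple_graph V E"
  defines "N \<equiv> card (adjacent_edge_pairs E)"
  shows "4 * (min_degree V E)\<^sup>2 * N \<le> second_hyper_zagreb E"
    and "second_hyper_zagreb E \<le> 4 * (max_degree V E)\<^sup>2 * N"
proof -
  have "of_nat N * (4 * (min_degree V E)\<^sup>2) \<le> second_hyper_zagreb E"
    unfolding second_hyper_zagreb_def N_def
    by (rule sum_bounded_below) (rule edge_pair_prod_bounds(1)[OF assms(1)])
  then show "4 * (min_degree V E)\<^sup>2 * N \<le> second_hyper_zagreb E" by (simp add: mult.commute)
  have "second_hyper_zagreb E \<le> of_nat N * (4 * (max_degree V E)\<^sup>2)"
    unfolding second_hyper_zagreb_def N_def
    by (rule sum_bounded_above) (rule edge_pair_prod_bounds(2)[OF assms(1)])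
  then show "second_hyper_zagreb E \<le> 4 * (max_degree V E)\<^sup>2 * N" by (simp add: mult.commute)
qed

section \<open>The equality cases\<close>

lemma edge_degrees_if_lower_tight:
  assumes G: "simple_graph V E"
    and tight: "second_hyper_zagreb E = 4 * (min_degree V E)\<^sup>2 * card (adjacent_edge_pairs E)"
    and ef: "e \<in> E" "f \<in> E" "e \<noteq> f" "e \<inter> f \<noteq> {}"
  shows "edge_degree E e = 2 * min_degree V E"
proof -
  let ?d = "min_degree V E"
  have "{e, f} \<in> adjacent_edge_pairs E" using ef unfolding adjacent_edge_pairs_def by blast
  moreover have "(\<Sum>p\<in>adjacent_edge_pairs E. 4 * ?d\<^sup>2) = second_hyper_zagreb E"
    using tight by simp
  \<comment> \<open>A termwise inequality between finite sums with equal totals is an equality in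
    every term.\<close>
  ultimately have "4 * ?d\<^sup>2 = (\<Prod>e\<in>{e, f}. edge_degree E e)"
    unfolding second_hyper_zagreb_def
    using sum_mono_inv[where f = "\<lambda>_. 4 * ?d\<^sup>2" and g = "\<lambda>p. \<Prod>e\<in>p. edge_degree E e"]
      edge_pair_prod_bounds(1)[OF G] finite_adjacent_edge_pairs[OF G]
    by blast
  then have eq: "2 * ?d * (2 * ?d) = edge_degree E e * edge_degree E f"
    using ef(3) by (simp add: power2_eq_square)
  note b = edge_degree_bounds(1)[OF G ef(1)] edge_degree_bounds(1)[OF G ef(2)]
  show ?thesis
  proof (rule ccontr)
    assume "edge_degree E e \<noteq> 2 * ?d"
    \<comment> \<open>Strict because d(f) > 0, also when \<delta> = 0. Since 2\<delta> \<le> d(f),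
      the product d(e) d(f) then exceeds 2\<delta> * 2\<delta>, against \<open>eq\<close>.\<close>
    then have "2 * ?d * edge_degree E f < edge_degree E e * edge_degree E f"
      using b(1) edge_degree_pos[OF G ef(2)] by simp
    then show False using eq mult_le_mono2[OF b(2), of "2 * ?d"] by linarith
  qed
qed

lemma edge_degrees_if_upper_tight:
  assumes G: "simple_graph V E"
    and tight: "second_hyper_zagreb E = 4 * (max_degree V E)\<^sup>2 * card (adjacent_edge_pairs E)"
    and ef: "e \<in> E" "f \<in> E" "e \<noteq> f" "e \<inter> f \<noteq> {}"
  shows "edge_degree E e = 2 * max_degree V E"
proof -
  let ?d = "max_degree V E"
  have "{e, f} \<in> adjacent_edge_pairs E" using ef unfolding adjacent_edge_pairs_def by blast
  moreover have "second_hyper_zagreb E = (\<Sum>p\<in>adjacent_edge_pairs E. 4 * ?d\<^sup>2)"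
    using tight by simp
  ultimately have "(\<Prod>e\<in>{e, f}. edge_degree E e) = 4 * ?d\<^sup>2"
    unfolding second_hyper_zagreb_def
    using sum_mono_inv[where g = "\<lambda>_. 4 * ?d\<^sup>2" and f = "\<lambda>p. \<Prod>e\<in>p. edge_degree E e"]
      edge_pair_prod_bounds(2)[OF G] finite_adjacent_edge_pairs[OF G]
    by blast
  then have eq: "edge_degree E e * edge_degree E f = 2 * ?d * (2 * ?d)"
    using ef(3) by (simp add: power2_eq_square)
  note b = edge_degree_bounds(2)[OF G ef(1)] edge_degree_bounds(2)[OF G ef(2)]
  show ?thesis
  proof (rule ccontr)
    assume "edge_degree E e \<noteq> 2 * ?d"
    \<comment> \<open>Mirror image of the lower case: lowering one factor strictly, with the other
      positive and at most 2\<Delta>, pushes the product below 2\<Delta> * 2\<Delta>.\<close>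
    then have "edge_degree E e * edge_degree E f < 2 * ?d * edge_degree E f"
      using b(1) edge_degree_pos[OF G ef(2)] by simp
    then show False using eq mult_le_mono2[OF b(2), of "2 * ?d"] by linarith
  qed
qed

lemma another_edge_if_degree_ge_2:
  assumes "2 \<le> degree E v"
  obtains f where "f \<in> E" "v \<in> f" "f \<noteq> e"
proof -
  have "\<not> {f \<in> E. v \<in> f} \<subseteq> {e}"
    using assms card_mono[of "{e}" "{f \<in> E. v \<in> f}"] unfolding degree_def by auto
  then show thesis using that by blast
qed

lemma degree_ge_2_if_adjacent:
  assumes "finite E" "e \<in> E" "f \<in> E" "e \<noteq> f" "v \<in> e" "v \<in> f"
  shows "2 \<le> degree E v"
  unfolding degree_def using assms card_mono[of "{e \<in> E. v \<in> e}" "{e, f}"] by auto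

lemma regular_if_lower_tight:
  assumes G: "simple_graph V E"
    and ne: "adjacent_edge_pairs E \<noteq> {}"
    and tight: "second_hyper_zagreb E = 4 * (min_degree V E)\<^sup>2 * card (adjacent_edge_pairs E)"
  shows "regular_graph V E"
proof -
  let ?d = "min_degree V E"
  have deg: "degree E v = ?d" if ge: "2 \<le> degree E v" for v
  proof -
    \<comment> \<open>Any edge at \<open>v\<close> will do here, so the excluded edge is left
      arbitrary; the next line then excludes \<open>e\<close> to get its neighbour.\<close>
    obtain e where e: "e \<in> E" "v \<in> e" using another_edge_if_degree_ge_2[OF ge] by blast
    obtain f where f: "f \<in> E" "v \<in> f" "f \<noteq> e" using another_edge_if_degree_ge_2[OF ge] by blast
    have "edge_degree E e = 2 * ?d"
      using edge_degrees_if_lower_tight[OF G tight] e f by blast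
    then show ?thesis using degree_eq_if_edge_degree_extremal(1)[OF G e] by simp
  qed
  obtain e f v where "e \<in> E" "f \<in> E" "e \<noteq> f" "v \<in> e" "v \<in> f"
    using ne unfolding adjacent_edge_pairs_def by blast
  then have "2 \<le> degree E v" by (rule degree_ge_2_if_adjacent[OF finite_edges[OF G]])
  \<comment> \<open>The common vertex has degree \<delta>, so the minimum itself is at least 2 and
    \<open>deg\<close> applies to every vertex.\<close>
  then have "2 \<le> ?d" using deg by metis
  then have "degree E u = ?d" if "u \<in> V" for u
    using deg degree_bounds(1)[OF G that] by simp
  then show ?thesis unfolding regular_graph_def by blast
qed

text \<open>A large maximum says nothing about vertices elsewhere: a triangle together with a
  disjoint edge attains the upper bound without being regular. Connectedness carries the degree
  \<Delta> from one vertex to all.\<close>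

lemma regular_if_upper_tight:
  assumes G: "simple_graph V E" and conn: "connected_graph V E"
    and ne: "adjacent_edge_pairs E \<noteq> {}"
    and tight: "second_hyper_zagreb E = 4 * (max_degree V E)\<^sup>2 * card (adjacent_edge_pairs E)"
  shows "regular_graph V E"
proof -
  let ?d = "max_degree V E"
  \<comment> \<open>The conclusion concerns every endpoint \<open>w\<close> of an edge at
    \<open>v\<close>, not only \<open>v\<close>, so that the induction below can pass to a
    neighbour.\<close>
  have deg: "degree E w = ?d" if ge: "2 \<le> degree E v" and e: "e \<in> E" "v \<in> e" "w \<in> e" for v w e
  proof -
    obtain f where f: "f \<in> E" "v \<in> f" "f \<noteq> e" using another_edge_if_degree_ge_2[OF ge] by blast
    have "edge_degree E e = 2 * ?d"
      using edge_degrees_if_upper_tight[OF G tight] e f by blast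
    then show ?thesis using degree_eq_if_edge_degree_extremal(2)[OF G e(1,3)] by simp
  qed
  obtain e f v where v: "e \<in> E" "f \<in> E" "e \<noteq> f" "v \<in> e" "v \<in> f"
    using ne unfolding adjacent_edge_pairs_def by blast
  then have "2 \<le> degree E v" by (rule degree_ge_2_if_adjacent[OF finite_edges[OF G]])
  moreover then have v_deg: "degree E v = ?d" using deg v by blast
  ultimately have ge: "2 \<le> ?d" by simp
  have "degree E u = ?d" if "u \<in> V" for u
  proof -
    have "v \<in> V" using G v unfolding simple_graph_def by auto
    then have "(v, u) \<in> {(x, y). {x, y} \<in> E}\<^sup>*"
      using conn that unfolding connected_graph_def by blast
    then show ?thesis
    proof (induction rule: rtrancl_induct)
      case base
      show ?case by (rule v_deg)
    next
      case (step y z)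
      \<comment> \<open>By induction \<open>y\<close> has degree \<Delta> \<ge> 2, so the edge from
        \<open>y\<close> to \<open>z\<close> has an adjacent edge at \<open>y\<close>, and
        \<open>deg\<close> reaches \<open>z\<close>.\<close>
      then show ?case using deg[of y "{y, z}" z] ge by simp
    qed
  qed
  then show ?thesis unfolding regular_graph_def by blast
qed

section \<open>Regular graphs and the real quotient \<open>R\<close>\<close>

lemma min_degree_eq_max_degree_if_regular:
  assumes "regular_graph V E" "V \<noteq> {}"
  shows "min_degree V E = max_degree V E"
proof -
  obtain k where "\<forall>v\<in>V. degree E v = k" using assms(1) unfolding regular_graph_def by blast
  \<comment> \<open>For empty \<open>V\<close> the image would be empty, and its \<open>Min\<close>
    and \<open>Max\<close> would carry no information.\<close>
  then have "degree E ` V = {k}" using assms(2) by auto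
  then show ?thesis unfolding min_degree_def max_degree_def by simp
qed

theorem theorem6:
  fixes V :: "'a set" and E :: "'a set set" and n m \<delta> \<Delta> :: nat and R :: real
  assumes "simple_graph V E"
    and "card V = n" and "card E = m"
    and "\<Delta> = max_degree V E" and "\<delta> = min_degree V E"
    and "first_zagreb V E \<noteq> 2 * m"
    and "R = real (second_hyper_zagreb E) / (2 * (real (first_zagreb V E) - 2 * real m))"
  shows "(real \<delta>)\<^sup>2 \<le> R \<and> R \<le> (real \<Delta>)\<^sup>2
    \<and> ((real \<delta>)\<^sup>2 = R \<and> R = (real \<Delta>)\<^sup>2 \<longleftrightarrow> regular_graph V E)
    \<and> ((real \<delta>)\<^sup>2 = R \<longleftrightarrow> regular_graph V E)
    \<and> (connected_graph V E \<longrightarrow> (R = (real \<Delta>)\<^sup>2 \<longleftrightarrow> regular_graph V E))"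
proof -
  note G = assms(1)
  define N where "N = card (adjacent_edge_pairs E)"
  define H where "H = second_hyper_zagreb E"
  have M: "first_zagreb V E = 2 * m + 2 * N"
    using first_zagreb_eq[OF G] assms(3) unfolding N_def by simp
  \<comment> \<open>The hypothesis that the denominator is nonzero says exactly that some two edges
    are adjacent.\<close>
  then have N: "N > 0" using assms(6) by simp
  then have ne: "adjacent_edge_pairs E \<noteq> {}" unfolding N_def by auto
  have V: "V \<noteq> {}" using ne adjacent_edge_pairs_eq_UN[OF G] by auto
  have R: "R = real H / (4 * real N)" using assms(7) M unfolding H_def by simp
  \<comment> \<open>Multiplying by 4\<open>N\<close> > 0 turns comparisons of \<open>R\<close> with
    a square into comparisons of natural numbers, where the counting lemmas apply.\<close>
  have le_iff: "real d ^ 2 \<le> R \<longleftrightarrow> 4 * d\<^sup>2 * N \<le> H"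
    and ge_iff: "R \<le> real d ^ 2 \<longleftrightarrow> H \<le> 4 * d\<^sup>2 * N" for d :: nat
  proof -
    have "real d ^ 2 \<le> R \<longleftrightarrow> real (4 * d\<^sup>2 * N) \<le> real H"
      unfolding R using N by (simp add: field_simps)
    then show "real d ^ 2 \<le> R \<longleftrightarrow> 4 * d\<^sup>2 * N \<le> H" by (simp only: of_nat_le_iff)
    have "R \<le> real d ^ 2 \<longleftrightarrow> real H \<le> real (4 * d\<^sup>2 * N)"
      unfolding R using N by (simp add: field_simps)
    then show "R \<le> real d ^ 2 \<longleftrightarrow> H \<le> 4 * d\<^sup>2 * N" by (simp only: of_nat_le_iff)
  qed
  have eq_iff: "real d ^ 2 = R \<longleftrightarrow> H = 4 * d\<^sup>2 * N" for d :: nat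
    using le_iff[of d] ge_iff[of d] by (metis order.eq_iff)
  have lower: "(real \<delta>)\<^sup>2 \<le> R" and upper: "R \<le> (real \<Delta>)\<^sup>2"
    using second_hyper_zagreb_bounds[OF G] assms(4,5) le_iff ge_iff
    unfolding N_def H_def by auto
  have lower_eq: "regular_graph V E" if "(real \<delta>)\<^sup>2 = R"
    using that regular_if_lower_tight[OF G ne] assms(5) eq_iff unfolding N_def H_def by simp
  have upper_eq: "regular_graph V E" if "connected_graph V E" "R = (real \<Delta>)\<^sup>2"
    using that(2) regular_if_upper_tight[OF G that(1) ne] assms(4) eq_iff[of \<Delta>]
    unfolding N_def H_def by simp
  \<comment> \<open>Regularity gives \<delta> = \<Delta>, so the two bounds squeeze
    \<open>R\<close>.\<close>
  have "(real \<delta>)\<^sup>2 = R \<and> R = (real \<Delta>)\<^sup>2" if "regular_graph V E"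
    using min_degree_eq_max_degree_if_regular[OF that V] assms(4,5) lower upper by simp
  then show ?thesis using lower upper lower_eq upper_eq by blast
qed

end
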